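(* Let $S\subset\mathbb{R}^n$ be nonempty and closed, let $I=\{1,\ldots,m\}$, $J=\{1,\ldots,p\}$, let $f_i^L,f_i^U,g_i^L,g_i^U\colon\mathbb{R}^n\to\mathbb{R}$ ($i\in I$) and $h_j\colon\mathbb{R}^n\to\mathbb{R}$ ($j\in J$) be locally Lipschitzian functions with $0\le f_i^L(x)\le f_i^U(x)$ and $0<g_i^L(x)\le g_i^U(x)$ for all $x\in S$, $i\in I$, and let $\Omega=\{x\in S: h_j(x)\le 0,\ j\in J\}$. Let $(\bar x,\bar\lambda^L,\bar\lambda^U,\bar\mu)\in\Omega_{MW}$ be a feasible point of the Mond--Weir dual problem. (i) If $\bar x\in\Omega$ and $(F,h)$ is generalized convex on $S$ at $\bar x$, then $\bar x$ is a type-2 weakly Pareto solution of the fractional interval-valued multiobjective problem (FIMP). (ii) If $\bar x\in\Omega$ and $(F,h)$ is strictly generalized convex on $S$ at $\bar x$, then $\bar x$ is a type-1 Pareto solution of (FIMP).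
   Context: Variational analysis. For $S\subset\mathbb{R}^n$, $x\in S$ and $\varepsilon\ge 0$, $\widehat N_\varepsilon(x;S):=\{z^*\in\mathbb{R}^n:\limsup_{u\to x,\,u\in S}\frac{\langle z^*,u-x\rangle}{\|u-x\|}\le\varepsilon\}$. The limiting (Mordukhovich) normal cone $N(\bar x;S)$ of $S$ at $\bar x\in\mathrm{cl}\,S$ is the set of all $z^*\in\mathbb{R}^n$ for which there exist $x^k\to\bar x$ with $x^k\in S$, $\varepsilon_k\to0^+$ and $z_k^*\to z^*$ with $z_k^*\in\widehat N_{\varepsilon_k}(x^k;S)$ for all $k$. For $\varphi\colon\mathbb{R}^n\to\overline{\mathbb{R}}$ finite at $\bar x$, the limiting (Mordukhovich) subdifferential is $\partial\varphi(\bar x):=\{x^*\in\mathbb{R}^n:(x^*,-1)\in N((\bar x,\varphi(\bar x));\mathrm{epi}\,\varphi)\}$, where $\mathrm{epi}\,\varphi=\{(x,\alpha)\in\mathbb{R}^n\times\mathbb{R}:\varphi(x)\le\alpha\}$. The upper subdifferential is $\partial^+\varphi(\bar x):=-\partial(-\varphi)(\bar x)$. The polar cone of a set $C\subset\mathbb{R}^n$ is $C^\circ:=\{x^*\in\mathbb{R}^n:\langle x^*,x\rangle\le0\ \forall x\in C\}$. Sums and scalar multiples of sets are taken elementwise (Minkowski). Primal problem. $f_i=[f_i^L,f_i^U]$ and $g_i=[g_i^L,g_i^U]$ are interval-valued functions; for $i\in I$ and $x\in S$, $F_i(x):=\frac{f_i(x)}{g_i(x)}=\left[\frac{f_i^L(x)}{g_i^U(x)},\frac{f_i^U(x)}{g_i^L(x)}\right]$,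 and $F=(F_1,\ldots,F_m)$. (FIMP) minimizes $F$ over $\Omega$ with respect to the LU order. For closed bounded intervals $A=[a^L,a^U]$, $B=[b^L,b^U]$: $A\le_{LU}B$ if $a^L\le b^L$ and $a^U\le b^U$; $A<_{LU}B$ if $A\le_{LU}B$ and $A\ne B$; $A<^s_{LU}B$ if $a^L<b^L$ and $a^U<b^U$. A point $\bar x\in\Omega$ is a type-1 Pareto solution of (FIMP) if there is no $x\in\Omega$ with $F_i(x)\le_{LU}F_i(\bar x)$ for all $i\in I$ and $F_k(x)<_{LU}F_k(\bar x)$ for at least one $k\in I$; it is a type-2 weakly Pareto solution of (FIMP) if there is no $x\in\Omega$ with $F_i(x)<^s_{LU}F_i(\bar x)$ for all $i\in I$. Dual feasible set. $\Omega_{MW}$ is the set of all $(y,\lambda^L,\lambda^U,\mu)\in S\times\mathbb{R}^m_+\times\mathbb{R}^m_+\times\mathbb{R}^p_+$ such that $$0\in \sum_{i\in I}\frac{\lambda_i^L}{g_i^U(y)} \left[\partial f_i^L(y)-\frac{f_i^L(y)}{g_i^U(y)}\partial^+ g_i^U(y)\right]+\sum_{i\in I}\frac{\lambda_i^U}{g_i^L(y)} \left[\partial f_i^U(y)-\frac{f_i^U(y)}{g_i^L(y)}\partial^+ g_i^L(y)\right]+\sum_{j\in J}\mu_j\partial h_j(y)+N(y;S),$$ $\sum_{j\in J}\mu_jh_j(y)\ge0$, $\sum_{i\in I}(\lambda_i^L+\lambda_i^U)+\sum_{j\in J}\mu_j=1$, and $(\lambda^L,\lambda^U)\ne(0,0)$.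 Generalized convexity. $(F,h)$ is generalized convex on $S$ at $\bar x\in S$ if for any $x\in S$, $x_i^{*L}\in\partial f_i^L(\bar x)$, $x_i^{*U}\in\partial f_i^U(\bar x)$, $y_i^{*L}\in\partial^+g_i^L(\bar x)$, $y_i^{*U}\in\partial^+g_i^U(\bar x)$, $i\in I$, and $z_j^*\in\partial h_j(\bar x)$, $j\in J$, there exists $\nu\in[N(\bar x;S)]^\circ$ such that for all $i\in I$, $j\in J$: $f_i^L(x)-f_i^L(\bar x)\ge\langle x_i^{*L},\nu\rangle$, $f_i^U(x)-f_i^U(\bar x)\ge\langle x_i^{*U},\nu\rangle$, $g_i^L(x)-g_i^L(\bar x)\le\langle y_i^{*L},\nu\rangle$, $g_i^U(x)-g_i^U(\bar x)\le\langle y_i^{*U},\nu\rangle$, $h_j(x)-h_j(\bar x)\ge\langle z_j^*,\nu\rangle$. $(F,h)$ is strictly generalized convex on $S$ at $\bar x$ if the same holds for any $x\in S\setminus\{\bar x\}$ (and any such subgradients) with the first two inequalities (those for $f_i^L$ and $f_i^U$) strict. *)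

theory Defs
  imports "HOL-Analysis.Analysis" "HOL-Library.Interval" "HOL-Library.Set_Algebras"
begin

section \<open>Variational analysis\<close>

text \<open>\<^term>\<open>at x within S\<close> excludes \<open>u = x\<close>; at an isolated point of \<open>S\<close> the upper limit is
  \<open>- \<infinity>\<close>, so every vector is then an \<open>\<epsilon>\<close>-normal.\<close>

definition eps_normals :: "real \<Rightarrow> 'a::euclidean_space \<Rightarrow> 'a set \<Rightarrow> 'a set" where
  "eps_normals \<epsilon> x S =
    {z. Limsup (at x within S) (\<lambda>u. ereal (inner z (u - x) / norm (u - x))) \<le> ereal \<epsilon>}"

definition normal_cone :: "'a::euclidean_space \<Rightarrow> 'a set \<Rightarrow> 'a set" where
  "normal_cone x S =
    {z. \<exists>X \<epsilon> Z. X \<longlonglongrightarrow> x \<and> (\<forall>k. X k \<in> S) \<and>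
       \<epsilon> \<longlonglongrightarrow> 0 \<and> (\<forall>k. \<epsilon> k > 0) \<and> Z \<longlonglongrightarrow> z \<and>
       (\<forall>k. Z k \<in> eps_normals (\<epsilon> k) (X k) S)}"

definition epi :: "('a \<Rightarrow> ereal) \<Rightarrow> ('a \<times> real) set" where
  "epi \<phi> = {(x, \<alpha>). \<phi> x \<le> ereal \<alpha>}"

text \<open>The subdifferential is only meaningful where \<open>\<phi>\<close> is finite; elsewhere it is set to be
  empty.\<close>

definition subdiff :: "('a::euclidean_space \<Rightarrow> ereal) \<Rightarrow> 'a \<Rightarrow> 'a set" where
  "subdiff \<phi> x =
    {z. \<bar>\<phi> x\<bar> \<noteq> \<infinity> \<and> (z, - 1) \<in> normal_cone (x, real_of_ereal (\<phi> x)) (epi \<phi>)}"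

definition upper_subdiff :: "('a::euclidean_space \<Rightarrow> ereal) \<Rightarrow> 'a \<Rightarrow> 'a set" where
  "upper_subdiff \<phi> x = uminus ` subdiff (\<lambda>u. - \<phi> u) x"

definition polar_cone :: "'a::real_inner set \<Rightarrow> 'a set" where
  "polar_cone C = {z. \<forall>x\<in>C. inner z x \<le> 0}"

definition locally_Lipschitz :: "('a::metric_space \<Rightarrow> 'b::metric_space) \<Rightarrow> bool" where
  "locally_Lipschitz f \<longleftrightarrow> (\<forall>x. \<exists>r>0. \<exists>L. L-lipschitz_on (ball x r) f)"

section \<open>The LU order on closed bounded intervals\<close>

text \<open>The order that the library puts on \<^typ>\<open>real interval\<close> is inclusion, not the LU order.\<close>

definition LU_le :: "real interval \<Rightarrow> real interval \<Rightarrow> bool" where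
  "LU_le A B \<longleftrightarrow> lower A \<le> lower B \<and> upper A \<le> upper B"

definition LU_less :: "real interval \<Rightarrow> real interval \<Rightarrow> bool" where
  "LU_less A B \<longleftrightarrow> LU_le A B \<and> A \<noteq> B"

definition LU_sless :: "real interval \<Rightarrow> real interval \<Rightarrow> bool" where
  "LU_sless A B \<longleftrightarrow> lower A < lower B \<and> upper A < upper B"

section \<open>The primal problem\<close>

text \<open>Interval-valued functions are given by their endpoint functions, since these are ordered
  only on \<open>S\<close>. The index sets are \<open>{1..m}\<close> and \<open>{1..p}\<close>; families and multiplier vectors are
  functions on \<^typ>\<open>nat\<close> of which only the values on these index sets matter.\<close>

type_synonym 'a family = "nat \<Rightarrow> 'a \<Rightarrow> real"

text \<open>\<^const>\<open>Interval\<close> is unspecified on pairs that are not ordered; the two lemmas below cover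
  every point of \<open>S\<close>.\<close>

definition frac_obj ::
  "'a family \<Rightarrow> 'a family \<Rightarrow> 'a family \<Rightarrow> 'a family \<Rightarrow> nat \<Rightarrow> 'a \<Rightarrow> real interval" where
  "frac_obj fL fU gL gU i x = Interval (fL i x / gU i x, fU i x / gL i x)"

lemma
  assumes "0 \<le> fL i x" "fL i x \<le> fU i x" "0 < gL i x" "gL i x \<le> gU i x"
  shows lower_frac_obj: "lower (frac_obj fL fU gL gU i x) = fL i x / gU i x"
    and upper_frac_obj: "upper (frac_obj fL fU gL gU i x) = fU i x / gL i x"
proof -
  have "fL i x / gU i x \<le> fU i x / gL i x"
    using assms by (intro frac_le) auto
  then show "lower (frac_obj fL fU gL gU i x) = fL i x / gU i x"
    and "upper (frac_obj fL fU gL gU i x) = fU i x / gL i x"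
    by (simp_all add: frac_obj_def lower.rep_eq upper.rep_eq Interval_inverse)
qed

definition feasible :: "'a set \<Rightarrow> nat \<Rightarrow> 'a family \<Rightarrow> 'a set" where
  "feasible S p h = {x \<in> S. \<forall>j\<in>{1..p}. h j x \<le> 0}"

definition type1_Pareto :: "'a set \<Rightarrow> nat \<Rightarrow> (nat \<Rightarrow> 'a \<Rightarrow> real interval) \<Rightarrow> 'a \<Rightarrow> bool" where
  "type1_Pareto \<Omega> m F xb \<longleftrightarrow> xb \<in> \<Omega> \<and>
    \<not> (\<exists>x\<in>\<Omega>. (\<forall>i\<in>{1..m}. LU_le (F i x) (F i xb)) \<and> (\<exists>k\<in>{1..m}. LU_less (F k x) (F k xb)))"

definition type2_weakly_Pareto ::
  "'a set \<Rightarrow> nat \<Rightarrow> (nat \<Rightarrow> 'a \<Rightarrow> real interval) \<Rightarrow> 'a \<Rightarrow> bool" where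
  "type2_weakly_Pareto \<Omega> m F xb \<longleftrightarrow> xb \<in> \<Omega> \<and>
    \<not> (\<exists>x\<in>\<Omega>. \<forall>i\<in>{1..m}. LU_sless (F i x) (F i xb))"

section \<open>The Mond--Weir dual feasible set\<close>

text \<open>On sets, \<open>+\<close>, \<open>\<Sum>\<close> and \<open>0 = {0}\<close> are the elementwise operations of \<^theory>\<open>HOL-Library.Set_Algebras\<close>,
  but \<open>-\<close> is set difference; hence \<open>A - c B\<close> is written as \<open>A + (- c) B\<close>.\<close>

definition Omega_MW ::
  "'a::euclidean_space set \<Rightarrow> nat \<Rightarrow> nat \<Rightarrow>
   'a family \<Rightarrow> 'a family \<Rightarrow> 'a family \<Rightarrow> 'a family \<Rightarrow> 'a family \<Rightarrow>
   ('a \<times> (nat \<Rightarrow> real) \<times> (nat \<Rightarrow> real) \<times> (nat \<Rightarrow> real)) set" where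
  "Omega_MW S m p fL fU gL gU h =
    {(y, lamL, lamU, mu).
      y \<in> S \<and>
      (\<forall>i\<in>{1..m}. 0 \<le> lamL i) \<and> (\<forall>i\<in>{1..m}. 0 \<le> lamU i) \<and> (\<forall>j\<in>{1..p}. 0 \<le> mu j) \<and>
      0 \<in> (\<Sum>i\<in>{1..m}. (*\<^sub>R) (lamL i / gU i y) `
             (subdiff (ereal \<circ> fL i) y +
              (*\<^sub>R) (- (fL i y / gU i y)) ` upper_subdiff (ereal \<circ> gU i) y))
        + (\<Sum>i\<in>{1..m}. (*\<^sub>R) (lamU i / gL i y) `
             (subdiff (ereal \<circ> fU i) y +
              (*\<^sub>R) (- (fU i y / gL i y)) ` upper_subdiff (ereal \<circ> gL i) y))
        + (\<Sum>j\<in>{1..p}. (*\<^sub>R) (mu j) ` subdiff (ereal \<circ> h j) y)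
        + normal_cone y S \<and>
      (\<Sum>j\<in>{1..p}. mu j * h j y) \<ge> 0 \<and>
      (\<Sum>i\<in>{1..m}. lamL i + lamU i) + (\<Sum>j\<in>{1..p}. mu j) = 1 \<and>
      \<not> (\<forall>i\<in>{1..m}. lamL i = 0 \<and> lamU i = 0)}"

section \<open>Generalized convexity\<close>

definition gen_convex ::
  "'a::euclidean_space set \<Rightarrow> nat \<Rightarrow> nat \<Rightarrow>
   'a family \<Rightarrow> 'a family \<Rightarrow> 'a family \<Rightarrow> 'a family \<Rightarrow> 'a family \<Rightarrow> 'a \<Rightarrow> bool" where
  "gen_convex S m p fL fU gL gU h xb \<longleftrightarrow>
    (\<forall>x\<in>S. \<forall>xL xU yL yU z.
      (\<forall>i\<in>{1..m}. xL i \<in> subdiff (ereal \<circ> fL i) xb \<and> xU i \<in> subdiff (ereal \<circ> fU i) xb \<and>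
        yL i \<in> upper_subdiff (ereal \<circ> gL i) xb \<and> yU i \<in> upper_subdiff (ereal \<circ> gU i) xb) \<and>
      (\<forall>j\<in>{1..p}. z j \<in> subdiff (ereal \<circ> h j) xb) \<longrightarrow>
      (\<exists>\<nu>\<in>polar_cone (normal_cone xb S).
        (\<forall>i\<in>{1..m}. fL i x - fL i xb \<ge> inner (xL i) \<nu> \<and> fU i x - fU i xb \<ge> inner (xU i) \<nu> \<and>
          gL i x - gL i xb \<le> inner (yL i) \<nu> \<and> gU i x - gU i xb \<le> inner (yU i) \<nu>) \<and>
        (\<forall>j\<in>{1..p}. h j x - h j xb \<ge> inner (z j) \<nu>)))"

definition strictly_gen_convex ::
  "'a::euclidean_space set \<Rightarrow> nat \<Rightarrow> nat \<Rightarrow>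
   'a family \<Rightarrow> 'a family \<Rightarrow> 'a family \<Rightarrow> 'a family \<Rightarrow> 'a family \<Rightarrow> 'a \<Rightarrow> bool" where
  "strictly_gen_convex S m p fL fU gL gU h xb \<longleftrightarrow>
    (\<forall>x\<in>S - {xb}. \<forall>xL xU yL yU z.
      (\<forall>i\<in>{1..m}. xL i \<in> subdiff (ereal \<circ> fL i) xb \<and> xU i \<in> subdiff (ereal \<circ> fU i) xb \<and>
        yL i \<in> upper_subdiff (ereal \<circ> gL i) xb \<and> yU i \<in> upper_subdiff (ereal \<circ> gU i) xb) \<and>
      (\<forall>j\<in>{1..p}. z j \<in> subdiff (ereal \<circ> h j) xb) \<longrightarrow>
      (\<exists>\<nu>\<in>polar_cone (normal_cone xb S).
        (\<forall>i\<in>{1..m}. fL i x - fL i xb > inner (xL i) \<nu> \<and> fU i x - fU i xb > inner (xU i) \<nu> \<and>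
          gL i x - gL i xb \<le> inner (yL i) \<nu> \<and> gU i x - gU i xb \<le> inner (yU i) \<nu>) \<and>
        (\<forall>j\<in>{1..p}. h j x - h j xb \<ge> inner (z j) \<nu>)))"

end

theory Submission
  imports Defs
begin

text \<open>
  Choose subgradients realizing the inclusion in the dual constraint and let \<open>\<nu>\<close> be the direction
  that (strict) generalized convexity provides for them and a competing feasible point \<open>x\<close>. Pairing
  the inclusion with \<open>\<nu>\<close> removes the normal vector and leaves a nonnegative combination of the
  linearized increments of the quotients and the constraints. The constraint part is at most
  \<open>\<Sum>j. \<mu>\<^sub>j h\<^sub>j(x) - \<Sum>j. \<mu>\<^sub>j h\<^sub>j(xb) \<le> 0\<close>. If \<open>x\<close> improved on \<open>xb\<close>, every linearized quotient
  increment would be negative, and since \<open>(\<lambda>\<^sup>L, \<lambda>\<^sup>U) \<noteq> 0\<close> the combination would be negative.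
\<close>

text \<open>One selection of subgradients is extracted before any competitor or direction is fixed,
  so that it can be handed to the convexity hypothesis, whose \<open>\<nu>\<close> depends on it.
  The inequality then holds for every \<open>\<nu>\<close> in the polar cone: the selected terms and
  a normal vector \<open>w\<close> sum to zero, and \<open>inner w \<nu> \<le> 0\<close> by
  polarity.\<close>

lemma dual_subgradients:
  fixes S :: "'a::euclidean_space set"
  assumes "(y, lamL, lamU, mu) \<in> Omega_MW S m p fL fU gL gU h"
  obtains xL xU yL yU z where
    "\<forall>i\<in>{1..m}. xL i \<in> subdiff (ereal \<circ> fL i) y"
    "\<forall>i\<in>{1..m}. xU i \<in> subdiff (ereal \<circ> fU i) y"
    "\<forall>i\<in>{1..m}. yL i \<in> upper_subdiff (ereal \<circ> gL i) y"
    "\<forall>i\<in>{1..m}. yU i \<in> upper_subdiff (ereal \<circ> gU i) y"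
    "\<forall>j\<in>{1..p}. z j \<in> subdiff (ereal \<circ> h j) y"
    "\<forall>\<nu>\<in>polar_cone (normal_cone y S).
       0 \<le> (\<Sum>i\<in>{1..m}. lamL i / gU i y * (inner (xL i) \<nu> - fL i y / gU i y * inner (yU i) \<nu>))
         + (\<Sum>i\<in>{1..m}. lamU i / gL i y * (inner (xU i) \<nu> - fU i y / gL i y * inner (yL i) \<nu>))
         + (\<Sum>j\<in>{1..p}. mu j * inner (z j) \<nu>)"
proof -
  define A where "A i = (*\<^sub>R) (lamL i / gU i y) `
    (subdiff (ereal \<circ> fL i) y + (*\<^sub>R) (- (fL i y / gU i y)) ` upper_subdiff (ereal \<circ> gU i) y)" for i
  define B where "B i = (*\<^sub>R) (lamU i / gL i y) `
    (subdiff (ereal \<circ> fU i) y + (*\<^sub>R) (- (fU i y / gL i y)) ` upper_subdiff (ereal \<circ> gL i) y)" for i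
  define C where "C j = (*\<^sub>R) (mu j) ` subdiff (ereal \<circ> h j) y" for j
  have "0 \<in> (\<Sum>i\<in>{1..m}. A i) + (\<Sum>i\<in>{1..m}. B i) + (\<Sum>j\<in>{1..p}. C j) + normal_cone y S"
    using assms by (simp add: Omega_MW_def A_def B_def C_def)
  then obtain sA sB sC w
    where zero: "0 = sA + sB + sC + w"
      and sA: "sA \<in> (\<Sum>i\<in>{1..m}. A i)" and sB: "sB \<in> (\<Sum>i\<in>{1..m}. B i)"
      and sC: "sC \<in> (\<Sum>j\<in>{1..p}. C j)" and w: "w \<in> normal_cone y S"
    by (elim set_plus_elim) metis
  \<comment> \<open>A member of a finite Minkowski sum is a sum of members, one selected from each
    summand.\<close>
  obtain a where a: "sA = (\<Sum>i\<in>{1..m}. a i)" "\<And>i. i \<in> {1..m} \<Longrightarrow> a i \<in> A i"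
    using sA by (auto simp: set_sum_alt)
  obtain b where b: "sB = (\<Sum>i\<in>{1..m}. b i)" "\<And>i. i \<in> {1..m} \<Longrightarrow> b i \<in> B i"
    using sB by (auto simp: set_sum_alt)
  obtain c where c: "sC = (\<Sum>j\<in>{1..p}. c j)" "\<And>j. j \<in> {1..p} \<Longrightarrow> c j \<in> C j"
    using sC by (auto simp: set_sum_alt)
  \<comment> \<open>Undoing both scalings in \<open>A\<close> exposes the linearized lower quotient.
    The lower endpoint is \<open>fL / gU\<close>, hence \<open>xL\<close> is paired with
    \<open>yU\<close> here, and \<open>xU\<close> with \<open>yL\<close> for the upper
    endpoint.\<close>
  have "\<forall>i\<in>{1..m}. \<exists>u v. u \<in> subdiff (ereal \<circ> fL i) y \<and> v \<in> upper_subdiff (ereal \<circ> gU i) y \<and>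
      a i = (lamL i / gU i y) *\<^sub>R (u - (fL i y / gU i y) *\<^sub>R v)"
    using a(2) unfolding A_def set_plus_def by fastforce
  then obtain xL yU where xL: "\<And>i. i \<in> {1..m} \<Longrightarrow> xL i \<in> subdiff (ereal \<circ> fL i) y"
      and yU: "\<And>i. i \<in> {1..m} \<Longrightarrow> yU i \<in> upper_subdiff (ereal \<circ> gU i) y"
      and a_eq: "\<And>i. i \<in> {1..m} \<Longrightarrow> a i = (lamL i / gU i y) *\<^sub>R (xL i - (fL i y / gU i y) *\<^sub>R yU i)"
    by metis
  have "\<forall>i\<in>{1..m}. \<exists>u v. u \<in> subdiff (ereal \<circ> fU i) y \<and> v \<in> upper_subdiff (ereal \<circ> gL i) y \<and>
      b i = (lamU i / gL i y) *\<^sub>R (u - (fU i y / gL i y) *\<^sub>R v)"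
    using b(2) unfolding B_def set_plus_def by fastforce
  then obtain xU yL where xU: "\<And>i. i \<in> {1..m} \<Longrightarrow> xU i \<in> subdiff (ereal \<circ> fU i) y"
      and yL: "\<And>i. i \<in> {1..m} \<Longrightarrow> yL i \<in> upper_subdiff (ereal \<circ> gL i) y"
      and b_eq: "\<And>i. i \<in> {1..m} \<Longrightarrow> b i = (lamU i / gL i y) *\<^sub>R (xU i - (fU i y / gL i y) *\<^sub>R yL i)"
    by metis
  have "\<forall>j\<in>{1..p}. \<exists>u. u \<in> subdiff (ereal \<circ> h j) y \<and> c j = mu j *\<^sub>R u"
    using c(2) unfolding C_def by blast
  then obtain z where z: "\<And>j. j \<in> {1..p} \<Longrightarrow> z j \<in> subdiff (ereal \<circ> h j) y"
      and c_eq: "\<And>j. j \<in> {1..p} \<Longrightarrow> c j = mu j *\<^sub>R z j"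
    by metis
  have "0 \<le> (\<Sum>i\<in>{1..m}. lamL i / gU i y * (inner (xL i) \<nu> - fL i y / gU i y * inner (yU i) \<nu>))
         + (\<Sum>i\<in>{1..m}. lamU i / gL i y * (inner (xU i) \<nu> - fU i y / gL i y * inner (yL i) \<nu>))
         + (\<Sum>j\<in>{1..p}. mu j * inner (z j) \<nu>)"
    if "\<nu> \<in> polar_cone (normal_cone y S)" for \<nu>
  proof -
    have "inner sA \<nu> + inner sB \<nu> + inner sC \<nu> + inner w \<nu> = 0"
      unfolding inner_add_left [symmetric] zero [symmetric] by simp
    moreover have "inner w \<nu> \<le> 0"
      using that w by (simp add: polar_cone_def inner_commute [of w])
    moreover have "inner sA \<nu> =
        (\<Sum>i\<in>{1..m}. lamL i / gU i y * (inner (xL i) \<nu> - fL i y / gU i y * inner (yU i) \<nu>))"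
      unfolding a(1) inner_sum_left by (intro sum.cong) (auto simp: a_eq inner_diff_left)
    moreover have "inner sB \<nu> =
        (\<Sum>i\<in>{1..m}. lamU i / gL i y * (inner (xU i) \<nu> - fU i y / gL i y * inner (yL i) \<nu>))"
      unfolding b(1) inner_sum_left by (intro sum.cong) (auto simp: b_eq inner_diff_left)
    moreover have "inner sC \<nu> = (\<Sum>j\<in>{1..p}. mu j * inner (z j) \<nu>)"
      unfolding c(1) inner_sum_left by (intro sum.cong) (auto simp: c_eq)
    ultimately show ?thesis by linarith
  qed
  then show ?thesis
    by (intro that [of xL xU yL yU z] ballI xL xU yL yU z)
qed

text \<open>Put \<open>q = f\<^sub>0 / g\<^sub>0\<close>. Since \<open>q \<ge> 0\<close>,
  \<open>q * b \<ge> q * (g - g\<^sub>0) = q * g - f\<^sub>0\<close>, so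
  \<open>a - q * b \<le> f - q * g \<le> 0\<close>. The first of these two bounds uses
  \<open>a \<le> f - f\<^sub>0\<close>, the second \<open>f / g \<le> q\<close>; strictness in
  either one suffices.\<close>

lemma linearized_quotient_neg:
  fixes a b f f\<^sub>0 g g\<^sub>0 :: real
  assumes "0 \<le> f\<^sub>0" "0 < g\<^sub>0" "0 < g"
    and "a \<le> f - f\<^sub>0" "g - g\<^sub>0 \<le> b" "f / g \<le> f\<^sub>0 / g\<^sub>0"
    and strict: "a < f - f\<^sub>0 \<or> f / g < f\<^sub>0 / g\<^sub>0"
  shows "a - f\<^sub>0 / g\<^sub>0 * b < 0"
proof -
  have "f\<^sub>0 / g\<^sub>0 * (g - g\<^sub>0) \<le> f\<^sub>0 / g\<^sub>0 * b"
    using assms by (intro mult_left_mono) auto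
  moreover have "f\<^sub>0 / g\<^sub>0 * (g - g\<^sub>0) = f\<^sub>0 / g\<^sub>0 * g - f\<^sub>0"
    using assms by (simp add: right_diff_distrib)
  moreover have "f \<le> f\<^sub>0 / g\<^sub>0 * g"
    using assms by (simp add: pos_divide_le_eq)
  moreover have "a < f - f\<^sub>0 \<or> f < f\<^sub>0 / g\<^sub>0 * g"
    using assms by (simp add: pos_divide_less_eq)
  ultimately show ?thesis using assms by linarith
qed

text \<open>Every term is nonpositive, and an index with a nonzero multiplier contributes a strictly
  negative one. Merging both sums into one over \<open>I\<close> lets that single index
  decide.\<close>

lemma multiplier_sum_neg:
  fixes lamL lamU a b :: "nat \<Rightarrow> real"
  assumes "\<And>i. i \<in> I \<Longrightarrow> 0 \<le> lamL i" "\<And>i. i \<in> I \<Longrightarrow> 0 \<le> lamU i"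
    and "\<not> (\<forall>i\<in>I. lamL i = 0 \<and> lamU i = 0)" and "finite I"
    and "\<And>i. i \<in> I \<Longrightarrow> a i < 0" "\<And>i. i \<in> I \<Longrightarrow> b i < 0"
  shows "(\<Sum>i\<in>I. lamL i * a i) + (\<Sum>i\<in>I. lamU i * b i) < 0"
proof -
  obtain k where k: "k \<in> I" "lamL k \<noteq> 0 \<or> lamU k \<noteq> 0"
    using assms(3) by blast
  have le: "lamL i * a i \<le> 0" "lamU i * b i \<le> 0" if "i \<in> I" for i
    using assms that by (simp_all add: mult_nonneg_nonpos less_imp_le)
  have "lamL k * a k < 0 \<or> lamU k * b k < 0"
    using assms k by (metis mult_pos_neg order_le_less)
  then have "lamL k * a k + lamU k * b k < 0"
    using le [OF k(1)] by linarith
  then have "(\<Sum>i\<in>I. lamL i * a i + lamU i * b i) < (\<Sum>i\<in>I. 0)"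
    using assms(4) k(1) le by (intro sum_strict_mono_ex1) (auto simp: add_nonpos_nonpos)
  then show ?thesis by (simp add: sum.distrib)
qed

theorem theorem4p3:
  fixes S :: "(real ^ 'n) set"
    and m p :: nat
    and fL fU gL gU h :: "nat \<Rightarrow> real ^ 'n \<Rightarrow> real"
    and xb :: "real ^ 'n"
    and lamL lamU mu :: "nat \<Rightarrow> real"
  assumes "S \<noteq> {}" and "closed S"
    and "\<And>i. i \<in> {1..m} \<Longrightarrow> locally_Lipschitz (fL i)"
    and "\<And>i. i \<in> {1..m} \<Longrightarrow> locally_Lipschitz (fU i)"
    and "\<And>i. i \<in> {1..m} \<Longrightarrow> locally_Lipschitz (gL i)"
    and "\<And>i. i \<in> {1..m} \<Longrightarrow> locally_Lipschitz (gU i)"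
    and "\<And>j. j \<in> {1..p} \<Longrightarrow> locally_Lipschitz (h j)"
    and "\<And>x i. x \<in> S \<Longrightarrow> i \<in> {1..m} \<Longrightarrow> 0 \<le> fL i x \<and> fL i x \<le> fU i x"
    and "\<And>x i. x \<in> S \<Longrightarrow> i \<in> {1..m} \<Longrightarrow> 0 < gL i x \<and> gL i x \<le> gU i x"
    and "(xb, lamL, lamU, mu) \<in> Omega_MW S m p fL fU gL gU h"
  shows "(xb \<in> feasible S p h \<and> gen_convex S m p fL fU gL gU h xb \<longrightarrow>
            type2_weakly_Pareto (feasible S p h) m (frac_obj fL fU gL gU) xb) \<and>
         (xb \<in> feasible S p h \<and> strictly_gen_convex S m p fL fU gL gU h xb \<longrightarrow>
            type1_Pareto (feasible S p h) m (frac_obj fL fU gL gU) xb)"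
proof -
  note f_nonneg = assms(8) and g_pos = assms(9) and dual = assms(10)
  let ?F = "frac_obj fL fU gL gU"
  have xb: "xb \<in> S"
    and lam: "\<And>i. i \<in> {1..m} \<Longrightarrow> 0 \<le> lamL i" "\<And>i. i \<in> {1..m} \<Longrightarrow> 0 \<le> lamU i"
    and lam_nz: "\<not> (\<forall>i\<in>{1..m}. lamL i = 0 \<and> lamU i = 0)"
    and mu: "\<And>j. j \<in> {1..p} \<Longrightarrow> 0 \<le> mu j"
    and compl: "0 \<le> (\<Sum>j\<in>{1..p}. mu j * h j xb)"
    using dual by (simp_all add: Omega_MW_def)
  have low: "lower (?F i x) = fL i x / gU i x" and upp: "upper (?F i x) = fU i x / gL i x"
    if "x \<in> S" "i \<in> {1..m}" for x i
    using f_nonneg [OF that] g_pos [OF that] by (simp_all add: lower_frac_obj upper_frac_obj)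
  obtain xL xU yL yU z where
    sub: "\<forall>i\<in>{1..m}. xL i \<in> subdiff (ereal \<circ> fL i) xb"
    "\<forall>i\<in>{1..m}. xU i \<in> subdiff (ereal \<circ> fU i) xb"
    "\<forall>i\<in>{1..m}. yL i \<in> upper_subdiff (ereal \<circ> gL i) xb"
    "\<forall>i\<in>{1..m}. yU i \<in> upper_subdiff (ereal \<circ> gU i) xb"
    "\<forall>j\<in>{1..p}. z j \<in> subdiff (ereal \<circ> h j) xb"
    and pairing: "\<forall>\<nu>\<in>polar_cone (normal_cone xb S).
       0 \<le> (\<Sum>i\<in>{1..m}. lamL i / gU i xb * (inner (xL i) \<nu> - fL i xb / gU i xb * inner (yU i) \<nu>))
         + (\<Sum>i\<in>{1..m}. lamU i / gL i xb * (inner (xU i) \<nu> - fU i xb / gL i xb * inner (yL i) \<nu>))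
         + (\<Sum>j\<in>{1..p}. mu j * inner (z j) \<nu>)"
    using dual by (rule dual_subgradients)
  \<comment> \<open>This serves both claims. The disjunction \<open>strict\<close> records where
    strictness comes from: for type-2 weak optimality from the competitor's strict improvement, for
    type-1 optimality from strict generalized convexity.\<close>
  have no_descent: False
    if \<nu>: "\<nu> \<in> polar_cone (normal_cone xb S)" and x: "x \<in> feasible S p h"
      and le: "\<And>i. i \<in> {1..m} \<Longrightarrow> LU_le (?F i x) (?F i xb)"
      and cvx: "\<And>i. i \<in> {1..m} \<Longrightarrow> inner (xL i) \<nu> \<le> fL i x - fL i xb \<and>
        inner (xU i) \<nu> \<le> fU i x - fU i xb \<and>
        gL i x - gL i xb \<le> inner (yL i) \<nu> \<and> gU i x - gU i xb \<le> inner (yU i) \<nu>"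
      and cvx_h: "\<And>j. j \<in> {1..p} \<Longrightarrow> inner (z j) \<nu> \<le> h j x - h j xb"
      and strict: "\<And>i. i \<in> {1..m} \<Longrightarrow> LU_sless (?F i x) (?F i xb) \<or>
        inner (xL i) \<nu> < fL i x - fL i xb \<and> inner (xU i) \<nu> < fU i x - fU i xb"
    for x \<nu>
  proof -
    have xS: "x \<in> S" and hx: "\<And>j. j \<in> {1..p} \<Longrightarrow> h j x \<le> 0"
      using x by (auto simp: feasible_def)
    have neg: "inner (xL i) \<nu> - fL i xb / gU i xb * inner (yU i) \<nu> < 0 \<and>
        inner (xU i) \<nu> - fU i xb / gL i xb * inner (yL i) \<nu> < 0" if i: "i \<in> {1..m}" for i
    proof (intro conjI)
      note facts = f_nonneg [OF xS i] f_nonneg [OF xb i] g_pos [OF xS i] g_pos [OF xb i] cvx [OF i]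
        le [OF i, unfolded LU_le_def low [OF xS i] low [OF xb i] upp [OF xS i] upp [OF xb i]]
        strict [OF i, unfolded LU_sless_def low [OF xS i] low [OF xb i] upp [OF xS i] upp [OF xb i]]
      \<comment> \<open>The values of numerator and denominator at the competitor do not occur in
        the goal, so they are supplied explicitly.\<close>
      show "inner (xL i) \<nu> - fL i xb / gU i xb * inner (yU i) \<nu> < 0"
        by (rule linearized_quotient_neg [of _ _ "gU i x" _ "fL i x"]) (use facts in auto)
      show "inner (xU i) \<nu> - fU i xb / gL i xb * inner (yL i) \<nu> < 0"
        by (rule linearized_quotient_neg [of _ _ "gL i x" _ "fU i x"]) (use facts in auto)
    qed
    have g_xb: "0 < gU i xb \<and> 0 < gL i xb" if "i \<in> {1..m}" for i
      using g_pos [OF xb that] by linarith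
    have "(\<Sum>i\<in>{1..m}. lamL i / gU i xb * (inner (xL i) \<nu> - fL i xb / gU i xb * inner (yU i) \<nu>))
        + (\<Sum>i\<in>{1..m}. lamU i / gL i xb * (inner (xU i) \<nu> - fU i xb / gL i xb * inner (yL i) \<nu>)) < 0"
    proof (rule multiplier_sum_neg)
      \<comment> \<open>The weights in the sums are the multipliers divided by positive
        denominators, so they cannot all vanish either.\<close>
      show "\<not> (\<forall>i\<in>{1..m}. lamL i / gU i xb = 0 \<and> lamU i / gL i xb = 0)"
        using lam_nz g_xb by (metis divide_eq_0_iff less_irrefl)
    qed (use lam g_xb neg in \<open>auto intro!: divide_nonneg_pos\<close>)
    moreover have "(\<Sum>j\<in>{1..p}. mu j * inner (z j) \<nu>) \<le> 0"
    proof -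
      \<comment> \<open>Feasibility of \<open>x\<close> gives
        \<open>inner (z j) \<nu> \<le> - h j xb\<close>; after weighting by \<open>mu\<close>, the
        dual condition \<open>compl\<close> bounds the sum by zero.\<close>
      have "(\<Sum>j\<in>{1..p}. mu j * inner (z j) \<nu>) \<le> (\<Sum>j\<in>{1..p}. - (mu j * h j xb))"
      proof (rule sum_mono)
        fix j assume j: "j \<in> {1..p}"
        have "inner (z j) \<nu> \<le> - h j xb"
          using cvx_h [OF j] hx [OF j] by linarith
        then show "mu j * inner (z j) \<nu> \<le> - (mu j * h j xb)"
          using mult_left_mono [OF _ mu [OF j]] by fastforce
      qed
      then show ?thesis using compl by (simp add: sum_negf)
    qed
    ultimately show False using bspec [OF pairing \<nu>] by linarith
  qed
  show ?thesis
  proof (intro conjI impI; elim conjE)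
    assume xb': "xb \<in> feasible S p h" and cvx: "gen_convex S m p fL fU gL gU h xb"
    have False if x: "x \<in> feasible S p h"
      and less: "\<forall>i\<in>{1..m}. LU_sless (?F i x) (?F i xb)" for x
    proof -
      have "x \<in> S" using x by (simp add: feasible_def)
      \<comment> \<open>Convexity is applied to the subgradients already fixed by the dual
        inclusion, so \<open>pairing\<close> covers the resulting direction.\<close>
      then obtain \<nu> where "\<nu> \<in> polar_cone (normal_cone xb S)"
        "\<forall>i\<in>{1..m}. fL i x - fL i xb \<ge> inner (xL i) \<nu> \<and> fU i x - fU i xb \<ge> inner (xU i) \<nu> \<and>
          gL i x - gL i xb \<le> inner (yL i) \<nu> \<and> gU i x - gU i xb \<le> inner (yU i) \<nu>"
        "\<forall>j\<in>{1..p}. h j x - h j xb \<ge> inner (z j) \<nu>"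
        using cvx sub unfolding gen_convex_def by metis
      then show False
        using less x by (intro no_descent [of \<nu> x]) (auto simp: LU_le_def LU_sless_def less_imp_le)
    qed
    then show "type2_weakly_Pareto (feasible S p h) m ?F xb"
      using xb' unfolding type2_weakly_Pareto_def by blast
  next
    assume xb': "xb \<in> feasible S p h" and cvx: "strictly_gen_convex S m p fL fU gL gU h xb"
    have False if x: "x \<in> feasible S p h"
      and le: "\<forall>i\<in>{1..m}. LU_le (?F i x) (?F i xb)"
      and less: "\<exists>k\<in>{1..m}. LU_less (?F k x) (?F k xb)" for x
    proof -
      \<comment> \<open>\<open>LU_less\<close> is irreflexive, so an improvement at some index
        forces \<open>x \<noteq> xb\<close>, as strict generalized convexity requires.\<close>
      have "x \<in> S - {xb}" using x less by (auto simp: feasible_def LU_less_def)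
      then obtain \<nu> where "\<nu> \<in> polar_cone (normal_cone xb S)"
        "\<forall>i\<in>{1..m}. fL i x - fL i xb > inner (xL i) \<nu> \<and> fU i x - fU i xb > inner (xU i) \<nu> \<and>
          gL i x - gL i xb \<le> inner (yL i) \<nu> \<and> gU i x - gU i xb \<le> inner (yU i) \<nu>"
        "\<forall>j\<in>{1..p}. h j x - h j xb \<ge> inner (z j) \<nu>"
        using cvx sub unfolding strictly_gen_convex_def by metis
      then show False
        using le x by (intro no_descent [of \<nu> x]) (auto simp: less_imp_le)
    qed
    then show "type1_Pareto (feasible S p h) m ?F xb"
      using xb' unfolding type1_Pareto_def by blast
  qed
qed

end
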